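(* Let $d\ge 3$, $\sigma>0$, $\mu_1,\mu_2\in\mathbb{R}$, and let $\epsilon_1,\dots,\epsilon_d$ be independent Gaussian random variables with mean $0$ and standard deviation $\sigma$. Let $X=(\mu_1+\epsilon_1,\mu_2+\epsilon_2,\epsilon_3,\dots,\epsilon_d)\in\mathbb{R}^d/\mathbb{R}{\bf 1}$, and let $X'\in\mathbb{R}^d/\mathbb{R}{\bf 1}$ be the projected point of $X$ onto the one-dimensional Stiefel tropical linear space $L(A_1)$ of the $2\times d$ matrix $$A_1=\begin{pmatrix}\mu_1&-\infty&0&\cdots&0\\-\infty&\mu_2&0&\cdots&0\end{pmatrix}.$$ Then $$d_{\rm tr}(X,X')=\max_{1\le i\le d}(\epsilon_i-\epsilon^* ),$$ where $\epsilon^*$ is the second smallest value in $\{\epsilon_1,\dots,\epsilon_d\}$ (counted with multiplicity), and $$\mathbb{E}[d_{\rm tr}(X,X')]\le 2\sigma\sqrt{2\log(d)}.$$ Specifically, $\lim_{\sigma\to 0}\mathbb{E}[d_{\rm tr}(X,X')]=0$.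
   Context: ${\bf 1}=(1,\dots,1)$, $[d]=\{1,\dots,d\}$. Tropical distance: $d_{\rm tr}(v,w)=\max_i(v_i-w_i)-\min_i(v_i-w_i)$. The tropical determinant of a $q\times q$ matrix $B$ over $\mathbb{R}\cup\{-\infty\}$ is $\mathrm{tdet}(B)=\max_{\sigma\in S_q}\sum_{i}B_{i,\sigma(i)}$. For an $m\times d$ matrix $A$ with $m<d$, $p_A(\omega)=\mathrm{tdet}(A_\omega)$ for $m$-subsets $\omega\subseteq[d]$, where $A_\omega$ consists of the columns of $A$ indexed by $\omega$; these are the tropical Plücker coordinates. The Stiefel tropical linear space $L(A)$ is the set of $x\in(\mathbb{R}\cup\{-\infty\})^d/\mathbb{R}{\bf 1}$ such that for every $(m+1)$-subset $\tau\subseteq[d]$ the maximum of $p_A(\tau\setminus\{t\})+x_t$ over $t\in\tau$ is attained at least twice. The projected point of $u\in\mathbb{R}^d/\mathbb{R}{\bf 1}$ onto $L(A)$ is the point $w$ given by the Blue Rule: $w_i=\max_{\tau}\min_{j\notin\tau}\{u_j+p_A(\tau\cup\{i\})-p_A(\tau\cup\{j\})\}$, where $\tau$ runs over $(m-1)$-subsets of $[d]$ not containing $i$; it is a known fact that $w\in L(A)$ and $w$ minimizes $d_{\rm tr}(u,\cdot)$ over $L(A)$. *)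

theory Defs
  imports "HOL-Probability.Probability"
begin

text \<open>
  Vectors of length \<open>d\<close> and matrices with \<open>d\<close> columns are functions on indices starting
  at 1; values outside \<open>{1..d}\<close> are irrelevant. A point of the tropical projective torus
  \<open>R^d / R(1,...,1)\<close> is given by an arbitrary representative \<open>nat \<Rightarrow> real\<close>; lemmas
  \<open>tropical_dist_shift\<close> and \<open>projected_point_shift\<close> show that the notions below do not
  depend on the choice. Matrix entries are extended reals other than \<open>\<infinity>\<close>.
\<close>

definition tropical_dist :: "nat \<Rightarrow> (nat \<Rightarrow> real) \<Rightarrow> (nat \<Rightarrow> real) \<Rightarrow> real" where
  "tropical_dist d v w = (MAX i\<in>{1..d}. v i - w i) - (MIN i\<in>{1..d}. v i - w i)"

definition tdet :: "nat \<Rightarrow> (nat \<Rightarrow> nat \<Rightarrow> ereal) \<Rightarrow> ereal" where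
  "tdet q B = (MAX \<pi>\<in>{\<pi>. \<pi> permutes {1..q}}. \<Sum>i=1..q. B i (\<pi> i))"

definition column_submatrix :: "(nat \<Rightarrow> nat \<Rightarrow> ereal) \<Rightarrow> nat set \<Rightarrow> nat \<Rightarrow> nat \<Rightarrow> ereal" where
  "column_submatrix A \<omega> i j = A i (sorted_list_of_set \<omega> ! (j - 1))"

definition plucker :: "nat \<Rightarrow> (nat \<Rightarrow> nat \<Rightarrow> ereal) \<Rightarrow> nat set \<Rightarrow> ereal" where
  "plucker m A \<omega> = tdet m (column_submatrix A \<omega>)"

definition max_attained_twice :: "(nat \<Rightarrow> ereal) \<Rightarrow> nat set \<Rightarrow> bool" where
  "max_attained_twice f T \<longleftrightarrow>
     (\<exists>s\<in>T. \<exists>t\<in>T. s \<noteq> t \<and> f s = f t \<and> (\<forall>r\<in>T. f r \<le> f s))"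

definition stiefel_linear_space ::
    "nat \<Rightarrow> nat \<Rightarrow> (nat \<Rightarrow> nat \<Rightarrow> ereal) \<Rightarrow> (nat \<Rightarrow> ereal) set" where
  "stiefel_linear_space m d A =
     {x. (\<forall>i\<in>{1..d}. x i \<noteq> \<infinity>) \<and>
         (\<forall>T. T \<subseteq> {1..d} \<and> card T = m + 1 \<longrightarrow>
           max_attained_twice (\<lambda>t. plucker m A (T - {t}) + x t) T)}"

definition blue_rule ::
    "nat \<Rightarrow> nat \<Rightarrow> (nat \<Rightarrow> nat \<Rightarrow> ereal) \<Rightarrow> (nat \<Rightarrow> real) \<Rightarrow> nat \<Rightarrow> ereal" where
  "blue_rule m d A u i =
     (MAX T\<in>{T. T \<subseteq> {1..d} - {i} \<and> card T = m - 1}.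
        MIN j\<in>{1..d} - T.
          ereal (u j) + plucker m A (insert i T) - plucker m A (insert j T))"

text \<open>
  When all Pluecker coordinates are finite, so is the value of the Blue Rule, and the
  conversion to \<open>real\<close> loses nothing (lemma \<open>ereal_projected_point\<close>).
\<close>

definition projected_point ::
    "nat \<Rightarrow> nat \<Rightarrow> (nat \<Rightarrow> nat \<Rightarrow> ereal) \<Rightarrow> (nat \<Rightarrow> real) \<Rightarrow> nat \<Rightarrow> real" where
  "projected_point m d A u i = real_of_ereal (blue_rule m d A u i)"

definition A1 :: "real \<Rightarrow> real \<Rightarrow> nat \<Rightarrow> nat \<Rightarrow> ereal" where
  "A1 \<mu>1 \<mu>2 i j =
     (if j = 1 then (if i = 1 then ereal \<mu>1 else -\<infinity>)
      else if j = 2 then (if i = 1 then -\<infinity> else ereal \<mu>2)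
      else 0)"

definition noisy_point :: "real \<Rightarrow> real \<Rightarrow> (nat \<Rightarrow> real) \<Rightarrow> nat \<Rightarrow> real" where
  "noisy_point \<mu>1 \<mu>2 e i =
     (if i = 1 then \<mu>1 + e 1 else if i = 2 then \<mu>2 + e 2 else e i)"

definition dist_to_projection :: "nat \<Rightarrow> real \<Rightarrow> real \<Rightarrow> (nat \<Rightarrow> real) \<Rightarrow> real" where
  "dist_to_projection d \<mu>1 \<mu>2 e =
     (let X = noisy_point \<mu>1 \<mu>2 e
      in tropical_dist d X (projected_point 2 d (A1 \<mu>1 \<mu>2) X))"

definition second_smallest :: "nat \<Rightarrow> (nat \<Rightarrow> real) \<Rightarrow> real" where
  "second_smallest d e = sort (map e [1..<Suc d]) ! 1"


lemma tropical_dist_shift: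
  assumes "1 \<le> d"
  shows "tropical_dist d (\<lambda>i. v i + a) (\<lambda>i. w i + b) = tropical_dist d v w"
proof -
  have ne: "{1..d} \<noteq> {}" using assms by auto
  have "(MAX i\<in>{1..d}. v i + a - (w i + b)) = (MAX i\<in>{1..d}. v i - w i) + (a - b)"
    using Max_add_commute[of "{1..d}" "\<lambda>i. v i - w i" "a - b"] ne
    by (simp add: algebra_simps)
  moreover have "(MIN i\<in>{1..d}. v i + a - (w i + b)) = (MIN i\<in>{1..d}. v i - w i) + (a - b)"
    using Min_add_commute[of "{1..d}" "\<lambda>i. v i - w i" "a - b"] ne
    by (simp add: algebra_simps)
  ultimately show ?thesis by (simp add: tropical_dist_def)
qed

context
  fixes m d :: nat and A :: "nat \<Rightarrow> nat \<Rightarrow> ereal"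
  assumes m: "1 \<le> m" "m < d"
    and fin: "\<And>\<omega>. \<omega> \<subseteq> {1..d} \<Longrightarrow> card \<omega> = m \<Longrightarrow> \<bar>plucker m A \<omega>\<bar> \<noteq> \<infinity>"
begin

private lemma candidate:
  assumes "i \<in> {1..d}" "T \<subseteq> {1..d} - {i}" "card T = m - 1"
  shows "{1..d} - T \<noteq> {}" "\<And>j. j \<in> {1..d} - T \<Longrightarrow> \<bar>plucker m A (insert j T)\<bar> \<noteq> \<infinity>"
    "\<bar>plucker m A (insert i T)\<bar> \<noteq> \<infinity>"
proof -
  have f: "finite T" using assms(2) finite_subset by fastforce
  show "{1..d} - T \<noteq> {}" using assms by auto
  show *: "\<bar>plucker m A (insert j T)\<bar> \<noteq> \<infinity>" if "j \<in> {1..d} - T" for j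
    using that assms f m by (intro fin) auto
  show "\<bar>plucker m A (insert i T)\<bar> \<noteq> \<infinity>" using assms by (intro *) auto
qed

private lemma candidates:
  assumes "i \<in> {1..d}"
  shows "finite {T. T \<subseteq> {1..d} - {i} \<and> card T = m - 1}"
    "{T. T \<subseteq> {1..d} - {i} \<and> card T = m - 1} \<noteq> {}"
proof -
  show "finite {T. T \<subseteq> {1..d} - {i} \<and> card T = m - 1}"
    by (rule finite_subset[of _ "Pow {1..d}"]) auto
  have "m - 1 \<le> card ({1..d} - {i})" using assms m by simp
  then obtain T where "T \<subseteq> {1..d} - {i}" "card T = m - 1"
    by (rule obtain_subset_with_card_n)
  then show "{T. T \<subseteq> {1..d} - {i} \<and> card T = m - 1} \<noteq> {}"
    by blast
qed

private lemma blue_rule_finite: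
  assumes i: "i \<in> {1..d}"
  shows "\<bar>blue_rule m d A u i\<bar> \<noteq> \<infinity>"
proof -
  let ?\<T> = "{T. T \<subseteq> {1..d} - {i} \<and> card T = m - 1}"
  let ?f = "\<lambda>T j. ereal (u j) + plucker m A (insert i T) - plucker m A (insert j T)"
  have "blue_rule m d A u i \<in> (\<lambda>T. MIN j\<in>{1..d} - T. ?f T j) ` ?\<T>"
    unfolding blue_rule_def using candidates[OF i] by (intro Max_in) auto
  then obtain T where T: "T \<in> ?\<T>" "blue_rule m d A u i = (MIN j\<in>{1..d} - T. ?f T j)"
    by auto
  have "(MIN j\<in>{1..d} - T. ?f T j) \<in> ?f T ` ({1..d} - T)"
    using candidate[OF i, of T] T(1) by (intro Min_in) auto
  then obtain j where j: "j \<in> {1..d} - T" "blue_rule m d A u i = ?f T j"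
    using T(2) by auto
  have "\<bar>plucker m A (insert i T)\<bar> \<noteq> \<infinity>" "\<bar>plucker m A (insert j T)\<bar> \<noteq> \<infinity>"
    using candidate[OF i, of T] T(1) j(1) by auto
  then show ?thesis unfolding j(2)
    by (cases "plucker m A (insert i T)"; cases "plucker m A (insert j T)") auto
qed

lemma ereal_projected_point:
  "i \<in> {1..d} \<Longrightarrow> ereal (projected_point m d A u i) = blue_rule m d A u i"
  using blue_rule_finite by (simp add: projected_point_def ereal_real')

lemma projected_point_shift:
  assumes i: "i \<in> {1..d}"
  shows "projected_point m d A (\<lambda>j. u j + c) i = projected_point m d A u i + c"
proof -
  let ?\<T> = "{T. T \<subseteq> {1..d} - {i} \<and> card T = m - 1}"
  let ?f = "\<lambda>u T j. ereal (u j) + plucker m A (insert i T) - plucker m A (insert j T)"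
  have mono: "mono (\<lambda>x. x + ereal c)"
    by (intro monoI add_right_mono)
  have "(MIN j\<in>{1..d} - T. ?f (\<lambda>j. u j + c) T j) = (MIN j\<in>{1..d} - T. ?f u T j) + ereal c"
    if T: "T \<in> ?\<T>" for T
  proof -
    have "?f (\<lambda>j. u j + c) T j = ?f u T j + ereal c" if "j \<in> {1..d} - T" for j
      using candidate[OF i, of T] T that
      by (cases "plucker m A (insert i T)"; cases "plucker m A (insert j T)") auto
    then have "(MIN j\<in>{1..d} - T. ?f (\<lambda>j. u j + c) T j)
        = Min ((\<lambda>x. x + ereal c) ` ?f u T ` ({1..d} - T))"
      unfolding image_image by (intro arg_cong[where f = Min] image_cong) auto
    also have "\<dots> = (MIN j\<in>{1..d} - T. ?f u T j) + ereal c"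
      using candidate(1)[OF i, of T] T by (subst mono_Min_commute[OF mono]) auto
    finally show ?thesis .
  qed
  then have "blue_rule m d A (\<lambda>j. u j + c) i
      = Max ((\<lambda>x. x + ereal c) ` (\<lambda>T. MIN j\<in>{1..d} - T. ?f u T j) ` ?\<T>)"
    unfolding blue_rule_def image_image by (intro arg_cong[where f = Max] image_cong) auto
  also have "\<dots> = blue_rule m d A u i + ereal c"
    unfolding blue_rule_def
    using candidates[OF i] by (subst mono_Max_commute[OF mono]) auto
  finally show ?thesis
    using blue_rule_finite[OF i, of u]
    by (cases "blue_rule m d A u i") (auto simp: projected_point_def)
qed

end

lemma tdet_2: "tdet 2 B = max (B 1 1 + B 2 2) (B 1 2 + B 2 1)"
proof -
  have s: "{1..2} = {1, 2::nat}" by auto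
  have "{\<pi>. \<pi> permutes {1, 2::nat}} = {id, Transposition.transpose 1 2}"
    unfolding permutes_insert[of "1::nat" "{2}"] by (force simp: image_iff)
  then show ?thesis
    unfolding tdet_def s by simp
qed

lemma plucker_A1:
  assumes "i \<noteq> j" "1 \<le> i" "1 \<le> j"
  shows "plucker 2 (A1 \<mu>1 \<mu>2) {i, j} =
    ereal (noisy_point \<mu>1 \<mu>2 (\<lambda>_. 0) i + noisy_point \<mu>1 \<mu>2 (\<lambda>_. 0) j)"
  using assms
proof (induction i j rule: linorder_wlog)
  case (le i j)
  then have "sorted_list_of_set {i, j} = [i, j]"
    by (intro sorted_list_of_set_unique[THEN iffD1]) auto
  with le show ?case
    by (auto simp: plucker_def tdet_2 column_submatrix_def A1_def noisy_point_def)
next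
  case (sym i j)
  then show ?case by (simp add: insert_commute add.commute)
qed

lemma plucker_A1_finite:
  assumes "\<omega> \<subseteq> {1..d}" "card \<omega> = 2"
  shows "\<bar>plucker 2 (A1 \<mu>1 \<mu>2) \<omega>\<bar> \<noteq> \<infinity>"
proof -
  obtain i j where "\<omega> = {i, j}" "i \<noteq> j" using assms(2) by (auto simp: card_2_iff)
  with assms(1) show ?thesis using plucker_A1[of i j \<mu>1 \<mu>2] by auto
qed

lemma blue_rule_A1:
  fixes u :: "nat \<Rightarrow> real" and \<mu>1 \<mu>2 :: real
  assumes i: "i \<in> {1..d}"
  defines "v \<equiv> \<lambda>j. u j - noisy_point \<mu>1 \<mu>2 (\<lambda>_. 0) j"
  shows "blue_rule 2 d (A1 \<mu>1 \<mu>2) u i =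
    (MAX k\<in>{1..d} - {i}. MIN j\<in>{1..d} - {k}.
      ereal (v j + noisy_point \<mu>1 \<mu>2 (\<lambda>_. 0) i))"
proof -
  have T: "{T. T \<subseteq> {1..d} - {i} \<and> card T = 2 - 1} = (\<lambda>k. {k}) ` ({1..d} - {i})"
    by (auto simp: card_1_singleton_iff)
  have "(MIN j\<in>{1..d} - {k}. ereal (u j) + plucker 2 (A1 \<mu>1 \<mu>2) {i, k} - plucker 2 (A1 \<mu>1 \<mu>2) {j, k})
      = (MIN j\<in>{1..d} - {k}. ereal (v j + noisy_point \<mu>1 \<mu>2 (\<lambda>_. 0) i))"
    if "k \<in> {1..d} - {i}" for k
    using that i by (intro arg_cong[where f = Min] image_cong) (auto simp: plucker_A1 v_def)
  then show ?thesis
    unfolding blue_rule_def T image_image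
    by (intro arg_cong[where f = Max] image_cong) auto
qed

lemma projected_point_A1:
  fixes u :: "nat \<Rightarrow> real" and \<mu>1 \<mu>2 :: real
  assumes d: "3 \<le> d" and i: "i \<in> {1..d}"
  defines "v \<equiv> \<lambda>j. u j - noisy_point \<mu>1 \<mu>2 (\<lambda>_. 0) j"
  shows "projected_point 2 d (A1 \<mu>1 \<mu>2) u i =
    (MAX k\<in>{1..d} - {i}. MIN j\<in>{1..d} - {k}. v j) + noisy_point \<mu>1 \<mu>2 (\<lambda>_. 0) i"
proof -
  let ?a = "noisy_point \<mu>1 \<mu>2 (\<lambda>_. 0) i"
  have mono: "mono (\<lambda>x. ereal (x + ?a))" by (intro monoI) auto
  have ne: "{1..d} - {k} \<noteq> {}" for k
  proof -
    have "card ({1..d} - {k}) \<ge> 2" using d by (cases "k \<in> {1..d}") auto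
    then show ?thesis by (metis card.empty not_numeral_le_zero)
  qed
  have *: "(MIN j\<in>{1..d} - {k}. ereal (v j + ?a)) = ereal ((MIN j\<in>{1..d} - {k}. v j) + ?a)" for k
    using ne by (subst mono_Min_commute[OF mono]) (auto simp: image_image)
  have "blue_rule 2 d (A1 \<mu>1 \<mu>2) u i
      = (MAX k\<in>{1..d} - {i}. ereal ((MIN j\<in>{1..d} - {k}. v j) + ?a))"
    unfolding blue_rule_A1[OF i] * [symmetric] by (simp add: v_def)
  also have "\<dots> = ereal ((MAX k\<in>{1..d} - {i}. MIN j\<in>{1..d} - {k}. v j) + ?a)"
    using ne by (subst mono_Max_commute[OF mono]) (auto simp: image_image)
  finally show ?thesis by (simp add: projected_point_def)
qed

lemma projected_point_A1_in_stiefel: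
  assumes d: "3 \<le> d"
  shows "(\<lambda>i. ereal (projected_point 2 d (A1 \<mu>1 \<mu>2) u i)) \<in> stiefel_linear_space 2 d (A1 \<mu>1 \<mu>2)"
proof -
  define a where "a = noisy_point \<mu>1 \<mu>2 (\<lambda>_. 0)"
  define g where "g k = (MIN j\<in>{1..d} - {k}. u j - a j)" for k
  define h where "h i = (MAX k\<in>{1..d} - {i}. g k)" for i
  have w: "projected_point 2 d (A1 \<mu>1 \<mu>2) u i = h i + a i" if "i \<in> {1..d}" for i
    using projected_point_A1[OF d that] by (simp add: h_def g_def a_def)
  have ne: "g ` {1..d} \<noteq> {}" using d by auto
  have "Max (g ` {1..d}) \<in> g ` {1..d}" using ne by (intro Max_in) auto
  then obtain k where k: "k \<in> {1..d}" "Max (g ` {1..d}) = g k" by auto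
  have ub: "g i \<le> g k" if "i \<in> {1..d}" for i
    using that unfolding k(2)[symmetric] by (intro Max_ge) auto
  have h_eq: "h i = g k" if "i \<noteq> k" for i
    unfolding h_def using that k ub by (intro Max_eqI) auto
  have h_le: "h i \<le> g k" for i
  proof -
    have "card ({1..d} - {i}) \<ge> 2" using d by (cases "i \<in> {1..d}") auto
    then have "{1..d} - {i} \<noteq> {}" by (metis card.empty not_numeral_le_zero)
    then show ?thesis unfolding h_def using ub by (subst Max_le_iff) auto
  qed
  have "max_attained_twice
      (\<lambda>t. plucker 2 (A1 \<mu>1 \<mu>2) (T - {t}) + ereal (projected_point 2 d (A1 \<mu>1 \<mu>2) u t)) T"
    if T: "T \<subseteq> {1..d}" "card T = 3" for T
  proof -
    have val: "plucker 2 (A1 \<mu>1 \<mu>2) (T - {t}) + ereal (projected_point 2 d (A1 \<mu>1 \<mu>2) u t)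
        = ereal (h t + sum a T)" if t: "t \<in> T" for t
    proof -
      have fin: "finite T" using T(1) finite_subset by blast
      have "card (T - {t}) = 2" using T t by simp
      then obtain p q where pq: "T - {t} = {p, q}" "p \<noteq> q" by (auto simp: card_2_iff)
      then have "p \<in> T" "q \<in> T" by auto
      then have "1 \<le> p" "1 \<le> q" using T(1) by auto
      moreover have "sum a T = a t + (a p + a q)"
        using pq fin t by (simp add: sum.remove[of T t])
      ultimately show ?thesis
        using pq T(1) t by (auto simp: plucker_A1 w a_def subset_iff)
    qed
    have "card (T - {k}) \<ge> 2" using T by (cases "k \<in> T") auto
    then obtain S where "S \<subseteq> T - {k}" "card S = 2" by (rule obtain_subset_with_card_n)
    then obtain s t where st: "s \<in> T" "t \<in> T" "s \<noteq> t" "s \<noteq> k" "t \<noteq> k"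
      by (auto simp: card_2_iff)
    then show ?thesis
      unfolding max_attained_twice_def
      by (intro bexI[of _ s] bexI[of _ t]) (auto simp: val h_eq h_le)
  qed
  then show ?thesis by (simp add: stiefel_linear_space_def)
qed

end

theory Submission
  imports Defs
begin

text \<open>
  Write \<open>a\<close> for the vector \<open>(\<mu>1, \<mu>2, 0, ..., 0)\<close>, so that \<open>X = a + \<epsilon>\<close>. The Pluecker coordinates
  of the matrix are \<open>p(ij) = a i + a j\<close>, hence \<open>L(A1)\<close> is the translate by \<open>a\<close> of the standard
  tropical line, and the Blue Rule gives
  \<open>X' i - a i = (MAX k \<noteq> i. MIN j \<noteq> k. \<epsilon> j)\<close>. The inner minimum is the smallest noise value
  unless \<open>k\<close> is the index \<open>k0\<close> of that value (any one of them in case of a tie), when it is the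
  second smallest value \<open>s\<close>.
  So \<open>X' - a\<close> agrees with \<open>s\<close> everywhere except at \<open>k0\<close>, where \<open>k = k0\<close> is forbidden and
  \<open>X'\<close> agrees with \<open>X\<close>. The coordinates of \<open>X - X'\<close> are therefore \<open>\<epsilon> i - s \<ge> 0\<close>
  for \<open>i \<noteq> k0\<close> and \<open>0\<close> for \<open>i = k0\<close> (\<open>projection_displacement\<close>); the least
  of them is \<open>0\<close> and the greatest is \<open>(MAX i. \<epsilon> i) - s\<close>.

  For the expectation, \<open>s\<close> is bounded below by the smallest value, so the distance is at most
  \<open>(MAX i. \<epsilon> i) + (MAX i. - \<epsilon> i)\<close>. Both terms are maxima of \<open>d\<close> centred Gaussian variables of
  standard deviation \<open>\<sigma>\<close>, and the classical moment generating function argument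
  (\<open>expectation_Max_subgaussian_le\<close>) bounds the expectation of each by
  \<open>\<sigma> * sqrt (2 * ln d)\<close>. The limit follows by squeezing the expectation between \<open>0\<close> and a
  multiple of \<open>\<sigma>\<close>.
\<close>

section \<open>The second smallest value\<close>

lemma atLeastAtMost_remove_nonempty: "2 \<le> d \<Longrightarrow> {1..d} - {k} \<noteq> {}" for d k :: nat
  by (cases "k = 1") (auto simp: Diff_eq_empty_iff subset_singleton_iff)

text \<open>
  The sorted list starts with the value at a minimizing index \<open>k\<close>, followed by the sorted
  list of the values at the other indices. This also covers a minimum that is attained several
  times: one occurrence is removed, and the others remain.
\<close>

lemma second_smallest_eq_Min:
  assumes d: "2 \<le> d" and k: "k \<in> {1..d}" and min: "\<And>j. j \<in> {1..d} \<Longrightarrow> e k \<le> e j"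
  shows "second_smallest d e = (MIN j\<in>{1..d} - {k}. e j)"
proof -
  define ys where "ys = sorted_list_of_multiset (image_mset e (mset_set ({1..d} - {k})))"
  have set_ys: "set ys = e ` ({1..d} - {k})"
    by (simp add: ys_def)
  note ne = atLeastAtMost_remove_nonempty[OF d, of k]
  have "mset (e k # ys) = image_mset e (mset_set (insert k ({1..d} - {k})))"
    by (simp add: ys_def del: insert_Diff_single)
  also have "insert k ({1..d} - {k}) = {1..d}"
    using k by auto
  also have "image_mset e (mset_set {1..d}) = mset (map e [1..<Suc d])"
    by (simp add: atLeastLessThanSuc_atLeastAtMost del: upt_Suc)
  finally have "sort (map e [1..<Suc d]) = e k # ys"
    using min set_ys by (intro properties_for_sort) (auto simp: ys_def)
  then have "second_smallest d e = ys ! 0"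
    unfolding second_smallest_def by simp
  also have "ys ! 0 = Min (set ys)"
  proof (cases ys)
    case Nil
    then show ?thesis using ne set_ys by auto
  next
    case (Cons y zs)
    moreover have "sorted ys" by (simp add: ys_def)
    ultimately show ?thesis by (intro Min_eqI[symmetric]) auto
  qed
  finally show ?thesis
    by (simp add: set_ys)
qed

lemma obtain_argmin:
  fixes e :: "nat \<Rightarrow> real"
  assumes "1 \<le> d"
  obtains k where "k \<in> {1..d}" "\<And>j. j \<in> {1..d} \<Longrightarrow> e k \<le> e j"
proof -
  have ne: "e ` {1..d} \<noteq> {}" using assms by auto
  then obtain k where "k \<in> {1..d}" "e k = Min (e ` {1..d})"
    using Min_in[of "e ` {1..d}"] by (metis finite_atLeastAtMost finite_imageI imageE)
  then show ?thesis using that by simp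
qed

lemma Min_remove_non_argmin:
  fixes e :: "nat \<Rightarrow> real"
  assumes "k \<in> {1..d}" "\<And>j. j \<in> {1..d} \<Longrightarrow> e k \<le> e j" "i \<noteq> k"
  shows "(MIN j\<in>{1..d} - {i}. e j) = e k"
  using assms by (intro Min_eqI) auto

lemma argmin_le_second_smallest:
  assumes "2 \<le> d" "k \<in> {1..d}" "\<And>j. j \<in> {1..d} \<Longrightarrow> e k \<le> e j"
  shows "e k \<le> second_smallest d e"
  using assms atLeastAtMost_remove_nonempty[of d k]
  by (subst second_smallest_eq_Min[of d k]) auto

text \<open>
  A formula free of any choice of minimizing index, which exhibits the second smallest value as
  an integrable function of the noise.
\<close>

lemma second_smallest_eq_Max_Min:
  assumes "2 \<le> d"
  shows "second_smallest d e = (MAX k\<in>{1..d}. MIN j\<in>{1..d} - {k}. e j)"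
proof -
  obtain k where k: "k \<in> {1..d}" "\<And>j. j \<in> {1..d} \<Longrightarrow> e k \<le> e j"
    using assms by (auto intro: obtain_argmin[of d e])
  have s: "second_smallest d e = (MIN j\<in>{1..d} - {k}. e j)"
    using assms k by (rule second_smallest_eq_Min)
  have "(MIN j\<in>{1..d} - {i}. e j) \<le> second_smallest d e" for i
  proof (cases "i = k")
    case False
    then show ?thesis
      using Min_remove_non_argmin[of k d e i] argmin_le_second_smallest[of d k e] k assms by simp
  qed (simp add: s)
  then show ?thesis
    using k(1) s by (intro Max_eqI[symmetric]) auto
qed

section \<open>The distance to the projected point\<close>

lemma noisy_point_eq: "noisy_point \<mu>1 \<mu>2 e i = e i + noisy_point \<mu>1 \<mu>2 (\<lambda>_. 0) i"
  by (simp add: noisy_point_def)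

text \<open>
  The Blue Rule at \<open>i\<close> maximizes over \<open>l \<noteq> i\<close> the least noise value left after removing
  \<open>l\<close>. Removing the minimizing index \<open>k\<close> is the best choice, and it is available exactly when
  \<open>i \<noteq> k\<close>; every other removal leaves the minimum \<open>e k\<close> in place.
\<close>

lemma projection_displacement:
  fixes \<mu>1 \<mu>2 :: real
  assumes d: "3 \<le> d" and k: "k \<in> {1..d}" "\<And>j. j \<in> {1..d} \<Longrightarrow> e k \<le> e j" and i: "i \<in> {1..d}"
  defines "X \<equiv> noisy_point \<mu>1 \<mu>2 e"
  shows "X i - projected_point 2 d (A1 \<mu>1 \<mu>2) X i = (if i = k then 0 else e i - second_smallest d e)"
proof -
  let ?g = "\<lambda>l. MIN j\<in>{1..d} - {l}. e j"
  have "X j - noisy_point \<mu>1 \<mu>2 (\<lambda>_. 0) j = e j" for j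
    unfolding X_def by (subst noisy_point_eq) simp
  then have "X i - projected_point 2 d (A1 \<mu>1 \<mu>2) X i = e i - (MAX l\<in>{1..d} - {i}. ?g l)"
    using projected_point_A1[OF d i, of \<mu>1 \<mu>2 X] by (simp add: algebra_simps)
  also have "(MAX l\<in>{1..d} - {i}. ?g l) = (if i = k then e k else second_smallest d e)"
  proof (cases "i = k")
    case True
    have "{1..d} - {k} \<noteq> {}"
      using d by (intro atLeastAtMost_remove_nonempty) simp
    then obtain l where "l \<in> {1..d} - {k}" by blast
    then show ?thesis
      using True Min_remove_non_argmin[of k d e] k by (intro Max_eqI) (auto simp: image_iff)
  next
    case False
    have "second_smallest d e = ?g k"
      using d by (intro second_smallest_eq_Min k) simp
    moreover have "?g l \<le> second_smallest d e" if "l \<in> {1..d}" for l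
      using that d by (subst second_smallest_eq_Max_Min) (auto intro!: Max_ge)
    ultimately show ?thesis
      using False k(1) by (intro Max_eqI) auto
  qed
  finally show ?thesis by simp
qed

lemma dist_to_projection_eq:
  assumes d: "3 \<le> d"
  shows "dist_to_projection d \<mu>1 \<mu>2 e = (MAX i\<in>{1..d}. e i - second_smallest d e)"
proof -
  obtain k where k: "k \<in> {1..d}" "\<And>j. j \<in> {1..d} \<Longrightarrow> e k \<le> e j"
    using d by (auto intro: obtain_argmin[of d e])
  define s where "s = second_smallest d e"
  define f where "f i = (if i = k then 0 else e i - s)" for i
  have s: "s = (MIN j\<in>{1..d} - {k}. e j)"
    unfolding s_def using d by (intro second_smallest_eq_Min k) auto
  have "{1..d} - {k} \<noteq> {}"
    using d by (intro atLeastAtMost_remove_nonempty) simp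
  then have "s \<in> e ` ({1..d} - {k})"
    unfolding s by (intro Min_in) auto
  then obtain l where l: "l \<in> {1..d}" "l \<noteq> k" "e l = s" by blast
  have s_le: "s \<le> e i" if "i \<in> {1..d}" "i \<noteq> k" for i
    using that by (auto simp: s)
  have ek: "e k \<le> s" using k(2)[OF l(1)] l(3) by simp
  have "noisy_point \<mu>1 \<mu>2 e i - projected_point 2 d (A1 \<mu>1 \<mu>2) (noisy_point \<mu>1 \<mu>2 e) i = f i"
    if "i \<in> {1..d}" for i
    unfolding f_def s_def using d k that by (rule projection_displacement)
  then have "(\<lambda>i. noisy_point \<mu>1 \<mu>2 e i
        - projected_point 2 d (A1 \<mu>1 \<mu>2) (noisy_point \<mu>1 \<mu>2 e) i) ` {1..d} = f ` {1..d}"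
    by (intro image_cong) auto
  then have "dist_to_projection d \<mu>1 \<mu>2 e = (MAX i\<in>{1..d}. f i) - (MIN i\<in>{1..d}. f i)"
    by (simp only: dist_to_projection_def tropical_dist_def Let_def)
  also have "(MIN i\<in>{1..d}. f i) = 0"
    using k(1) s_le by (intro Min_eqI) (auto simp: f_def image_iff)
  also have "(MAX i\<in>{1..d}. f i) = (MAX i\<in>{1..d}. e i - s)"
    \<comment> \<open>The two families differ only at \<open>k\<close>, where both values are at most the value \<open>0\<close> which both
        families take at \<open>l\<close>.\<close>
  proof (rule antisym)
    have "f i \<le> (MAX i\<in>{1..d}. e i - s)" if "i \<in> {1..d}" for i
    proof -
      have "f i \<in> (\<lambda>i. e i - s) ` {1..d}"
        using that l by (cases "i = k") (auto simp: f_def)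
      then show ?thesis by (intro Max_ge) auto
    qed
    then show "(MAX i\<in>{1..d}. f i) \<le> (MAX i\<in>{1..d}. e i - s)"
      using k(1) by (subst Max_le_iff) auto
    have "e i - s \<le> (MAX i\<in>{1..d}. f i)" if "i \<in> {1..d}" for i
    proof -
      have "e i - s \<le> f i" using ek by (simp add: f_def)
      also have "f i \<le> (MAX i\<in>{1..d}. f i)" using that by (intro Max_ge) auto
      finally show ?thesis .
    qed
    then show "(MAX i\<in>{1..d}. e i - s) \<le> (MAX i\<in>{1..d}. f i)"
      using k(1) by (subst Max_le_iff) auto
  qed
  finally show ?thesis by (simp add: s_def)
qed

text \<open>
  The upper bound trades the second smallest value for the smallest one, so that only maxima over
  all indices remain, of the noise and of its negative.
\<close>

lemma spread_above_second_smallest: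
  assumes d: "2 \<le> d"
  shows "(MAX i\<in>{1..d}. e i - second_smallest d e) = (MAX i\<in>{1..d}. e i) - second_smallest d e"
    and "0 \<le> (MAX i\<in>{1..d}. e i - second_smallest d e)"
    and "(MAX i\<in>{1..d}. e i - second_smallest d e) \<le> (MAX i\<in>{1..d}. e i) + (MAX i\<in>{1..d}. - e i)"
proof -
  obtain k where k: "k \<in> {1..d}" "\<And>j. j \<in> {1..d} \<Longrightarrow> e k \<le> e j"
    using d by (auto intro: obtain_argmin[of d e])
  show eq: "(MAX i\<in>{1..d}. e i - second_smallest d e) = (MAX i\<in>{1..d}. e i) - second_smallest d e"
    using Max_add_commute[of "{1..d}" e "- second_smallest d e"] k(1) by auto
  have "{1..d} - {k} \<noteq> {}"
    using d by (intro atLeastAtMost_remove_nonempty) simp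
  then have "(MIN j\<in>{1..d} - {k}. e j) \<in> e ` ({1..d} - {k})"
    by (intro Min_in) auto
  then have "second_smallest d e \<in> e ` {1..d}"
    using second_smallest_eq_Min[of d k e] d k by auto
  then show "0 \<le> (MAX i\<in>{1..d}. e i - second_smallest d e)"
    unfolding eq by simp
  have "- e k \<le> (MAX i\<in>{1..d}. - e i)"
    using k(1) by (intro Max_ge) auto
  then show "(MAX i\<in>{1..d}. e i - second_smallest d e)
      \<le> (MAX i\<in>{1..d}. e i) + (MAX i\<in>{1..d}. - e i)"
    unfolding eq using argmin_le_second_smallest[of d k e, OF d k] by linarith
qed

section \<open>Expected maxima of Gaussian variables\<close>

text \<open>Completing the square: exponential tilting of a normal density shifts its mean.\<close>

lemma exp_times_normal_density:
  assumes "0 < \<sigma>"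
  shows "normal_density \<mu> \<sigma> x * exp (t * x)
    = exp (t * \<mu> + t\<^sup>2 * \<sigma>\<^sup>2 / 2) * normal_density (\<mu> + t * \<sigma>\<^sup>2) \<sigma> x"
proof -
  have "- (x - \<mu>)\<^sup>2 / (2 * \<sigma>\<^sup>2) + t * x
      = t * \<mu> + t\<^sup>2 * \<sigma>\<^sup>2 / 2 + - (x - (\<mu> + t * \<sigma>\<^sup>2))\<^sup>2 / (2 * \<sigma>\<^sup>2)"
    using assms by (simp add: field_simps power2_eq_square)
  then show ?thesis
    by (simp add: normal_density_def exp_add[symmetric])
qed

lemma (in prob_space) normal_mgf:
  assumes X: "distributed M lborel X (normal_density \<mu> \<sigma>)" and \<sigma>: "0 < \<sigma>"
  shows "integrable M (\<lambda>\<omega>. exp (t * X \<omega>))"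
    and "expectation (\<lambda>\<omega>. exp (t * X \<omega>)) = exp (t * \<mu> + t\<^sup>2 * \<sigma>\<^sup>2 / 2)"
proof -
  show "integrable M (\<lambda>\<omega>. exp (t * X \<omega>))"
    by (subst distributed_integrable[OF X, symmetric])
       (auto simp: exp_times_normal_density \<sigma>)
  have "expectation (\<lambda>\<omega>. exp (t * X \<omega>)) = (\<integral>x. normal_density \<mu> \<sigma> x * exp (t * x) \<partial>lborel)"
    by (subst distributed_integral[OF X, of "\<lambda>x. exp (t * x)"]) auto
  then show "expectation (\<lambda>\<omega>. exp (t * X \<omega>)) = exp (t * \<mu> + t\<^sup>2 * \<sigma>\<^sup>2 / 2)"
    by (simp add: exp_times_normal_density \<sigma>)
qed

text \<open>
  The exponential of \<open>t\<close> times a maximum is at most the sum of the exponentials, whose expectation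
  is at most \<open>c = n * exp (t^2 * \<sigma>^2 / 2)\<close> for \<open>n\<close> variables. Instead of Jensen's inequality, the
  tangent line bound \<open>ln y \<le> y / c - 1 + ln c\<close>, valid for \<open>y > 0\<close>, turns this into
  \<open>t * E (MAX i. X i) \<le> ln c = ln n + t^2 * \<sigma>^2 / 2\<close>.
  The choice \<open>t = sqrt (2 * ln n) / \<sigma>\<close> is optimal; it is positive because \<open>n \<ge> 2\<close>.
\<close>

lemma (in prob_space) expectation_Max_subgaussian_le:
  fixes X :: "'i \<Rightarrow> 'a \<Rightarrow> real"
  assumes I: "2 \<le> card I" and \<sigma>: "0 < \<sigma>"
    and int: "\<And>i. i \<in> I \<Longrightarrow> integrable M (X i)"
    and int_exp: "\<And>i t. i \<in> I \<Longrightarrow> 0 < t \<Longrightarrow> integrable M (\<lambda>\<omega>. exp (t * X i \<omega>))"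
    and mgf: "\<And>i t. i \<in> I \<Longrightarrow> 0 < t \<Longrightarrow> expectation (\<lambda>\<omega>. exp (t * X i \<omega>)) \<le> exp (t\<^sup>2 * \<sigma>\<^sup>2 / 2)"
  shows "expectation (\<lambda>\<omega>. MAX i\<in>I. X i \<omega>) \<le> \<sigma> * sqrt (2 * ln (card I))"
proof -
  have fin: "finite I" and ne: "I \<noteq> {}"
    using I card.infinite by fastforce+
  define L where "L = ln (real (card I))"
  have L: "0 < L" using I by (simp add: L_def)
  define t where "t = sqrt (2 * L) / \<sigma>"
  have t: "0 < t" using L \<sigma> by (simp add: t_def)
  define c where "c = card I * exp (t\<^sup>2 * \<sigma>\<^sup>2 / 2)"
  have c: "0 < c" using I by (simp add: c_def)
  have sq: "t\<^sup>2 * \<sigma>\<^sup>2 = 2 * L"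
    using L \<sigma> by (simp add: t_def power_divide)
  have ln_c: "ln c = 2 * L"
    using I sq by (simp add: c_def ln_mult L_def)
  let ?Y = "\<lambda>\<omega>. MAX i\<in>I. X i \<omega>"
  have intY: "integrable M ?Y"
    using fin ne int by (rule integrable_MAX)
  have "t * ?Y \<omega> \<le> (\<Sum>i\<in>I. exp (t * X i \<omega>)) / c - 1 + ln c" for \<omega>
  proof -
    have "?Y \<omega> \<in> (\<lambda>i. X i \<omega>) ` I"
      using fin ne by (intro Max_in) auto
    then obtain i where i: "i \<in> I" "?Y \<omega> = X i \<omega>" by auto
    have "t * ?Y \<omega> - ln c = ln (exp (t * ?Y \<omega>) / c)"
      using c by (simp add: ln_div)
    also have "\<dots> \<le> exp (t * ?Y \<omega>) / c - 1"
      using c by (intro ln_le_minus_one) simp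
    also have "exp (t * ?Y \<omega>) \<le> (\<Sum>i\<in>I. exp (t * X i \<omega>))"
      unfolding i(2) using fin i(1) by (intro member_le_sum) auto
    finally show ?thesis using c by (simp add: divide_right_mono)
  qed
  then have "expectation (\<lambda>\<omega>. t * ?Y \<omega>) \<le> expectation (\<lambda>\<omega>. (\<Sum>i\<in>I. exp (t * X i \<omega>)) / c - 1 + ln c)"
    using intY int_exp t by (intro integral_mono) auto
  also have "\<dots> = (\<Sum>i\<in>I. expectation (\<lambda>\<omega>. exp (t * X i \<omega>))) / c - 1 + ln c"
    using int_exp t by (simp add: prob_space)
  also have "(\<Sum>i\<in>I. expectation (\<lambda>\<omega>. exp (t * X i \<omega>))) \<le> c"
    using sum_mono[of I, OF mgf[OF _ t]] by (simp add: c_def)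
  finally have "t * expectation ?Y \<le> 2 * L"
    using c by (simp add: divide_right_mono ln_c)
  then have "expectation ?Y \<le> 2 * L / t"
    using t by (simp add: field_simps)
  also have "2 * L / t = \<sigma> * sqrt (2 * L)"
    using L \<sigma> by (simp add: t_def field_simps)
  finally show ?thesis by (simp add: L_def)
qed

lemma (in prob_space) integrable_normal:
  assumes "distributed M lborel X (normal_density \<mu> \<sigma>)" "0 < \<sigma>"
  shows "integrable M X"
  using assms by (intro distributed_integrable_var[OF assms(1)] integrable_normal_moment_nz_1) auto

lemma (in prob_space) expectation_Max_normal_le:
  assumes "2 \<le> card I" "0 < \<sigma>"
    and "\<And>i. i \<in> I \<Longrightarrow> distributed M lborel (X i) (normal_density 0 \<sigma>)"
  shows "expectation (\<lambda>\<omega>. MAX i\<in>I. X i \<omega>) \<le> \<sigma> * sqrt (2 * ln (card I))"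
proof (rule expectation_Max_subgaussian_le[OF assms(1,2)])
  fix i t assume "i \<in> I"
  note X = assms(3)[OF this]
  show "integrable M (X i)"
    using X assms(2) by (rule integrable_normal)
  show "integrable M (\<lambda>\<omega>. exp (t * X i \<omega>))"
    using X assms(2) by (rule normal_mgf)
  show "expectation (\<lambda>\<omega>. exp (t * X i \<omega>)) \<le> exp (t\<^sup>2 * \<sigma>\<^sup>2 / 2)"
    using normal_mgf(2)[OF X assms(2), of t] by simp
qed

section \<open>The expected distance\<close>

lemma (in prob_space) expected_spread_normal:
  fixes e :: "nat \<Rightarrow> 'a \<Rightarrow> real"
  assumes d: "2 \<le> d" and \<sigma>: "0 < \<sigma>"
    and e: "\<And>i. i \<in> {1..d} \<Longrightarrow> distributed M lborel (e i) (normal_density 0 \<sigma>)"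
  defines "D \<equiv> \<lambda>\<omega>. MAX i\<in>{1..d}. e i \<omega> - second_smallest d (\<lambda>i. e i \<omega>)"
  shows "integrable M D" and "0 \<le> expectation D" and "expectation D \<le> 2 * \<sigma> * sqrt (2 * ln d)"
proof -
  have ne: "{1..d} \<noteq> {}" using d by auto
  note ne' = atLeastAtMost_remove_nonempty[OF d]
  have neg: "distributed M lborel (\<lambda>\<omega>. - e i \<omega>) (normal_density 0 \<sigma>)" if "i \<in> {1..d}" for i
    using normal_density_affine[OF e[OF that] \<sigma>, of "-1" 0] by simp
  have int: "integrable M (e i)" "integrable M (\<lambda>\<omega>. - e i \<omega>)" if "i \<in> {1..d}" for i
    using integrable_normal[OF e[OF that] \<sigma>] by auto
  show intD: "integrable M D"
    unfolding D_def spread_above_second_smallest(1)[OF d] second_smallest_eq_Max_Min[OF d]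
    using ne ne' int by (intro Bochner_Integration.integrable_diff integrable_MAX integrable_MIN) auto
  show "0 \<le> expectation D"
    unfolding D_def by (intro Bochner_Integration.integral_nonneg) (rule spread_above_second_smallest(2)[OF d])
  have intM: "integrable M (\<lambda>\<omega>. MAX i\<in>{1..d}. e i \<omega>)" "integrable M (\<lambda>\<omega>. MAX i\<in>{1..d}. - e i \<omega>)"
    using ne int by (auto intro!: integrable_MAX)
  have "expectation D \<le> expectation (\<lambda>\<omega>. (MAX i\<in>{1..d}. e i \<omega>) + (MAX i\<in>{1..d}. - e i \<omega>))"
    using intD Bochner_Integration.integrable_add[OF intM]
    by (rule integral_mono) (unfold D_def, rule spread_above_second_smallest(3)[OF d])
  also have "\<dots> = expectation (\<lambda>\<omega>. MAX i\<in>{1..d}. e i \<omega>) + expectation (\<lambda>\<omega>. MAX i\<in>{1..d}. - e i \<omega>)"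
    using intM by simp
  also have "\<dots> \<le> \<sigma> * sqrt (2 * ln d) + \<sigma> * sqrt (2 * ln d)"
    using expectation_Max_normal_le[of "{1..d}" \<sigma> e, OF _ \<sigma> e]
      expectation_Max_normal_le[of "{1..d}" \<sigma> "\<lambda>i \<omega>. - e i \<omega>", OF _ \<sigma> neg] d
    by (intro add_mono) auto
  finally show "expectation D \<le> 2 * \<sigma> * sqrt (2 * ln d)" by simp
qed

theorem theorem10:
  fixes d :: nat and \<mu>1 \<mu>2 :: real
    and M :: "real \<Rightarrow> 'a measure" and \<epsilon> :: "real \<Rightarrow> nat \<Rightarrow> 'a \<Rightarrow> real"
  assumes "3 \<le> d"
    and "\<And>\<sigma>. 0 < \<sigma> \<Longrightarrow> prob_space (M \<sigma>)"
    and "\<And>\<sigma>. 0 < \<sigma> \<Longrightarrow> prob_space.indep_vars (M \<sigma>) (\<lambda>_. borel) (\<epsilon> \<sigma>) {1..d}"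
    and "\<And>\<sigma> i. 0 < \<sigma> \<Longrightarrow> i \<in> {1..d} \<Longrightarrow>
           distributed (M \<sigma>) lborel (\<epsilon> \<sigma> i) (normal_density 0 \<sigma>)"
  shows "(\<forall>\<sigma>>0.
            (\<forall>\<omega>\<in>space (M \<sigma>). dist_to_projection d \<mu>1 \<mu>2 (\<lambda>i. \<epsilon> \<sigma> i \<omega>) =
               (MAX i\<in>{1..d}. \<epsilon> \<sigma> i \<omega> - second_smallest d (\<lambda>i. \<epsilon> \<sigma> i \<omega>))) \<and>
            integrable (M \<sigma>) (\<lambda>\<omega>. dist_to_projection d \<mu>1 \<mu>2 (\<lambda>i. \<epsilon> \<sigma> i \<omega>)) \<and>
            prob_space.expectation (M \<sigma>) (\<lambda>\<omega>. dist_to_projection d \<mu>1 \<mu>2 (\<lambda>i. \<epsilon> \<sigma> i \<omega>))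
              \<le> 2 * \<sigma> * sqrt (2 * ln (real d))) \<and>
         ((\<lambda>\<sigma>. prob_space.expectation (M \<sigma>)
             (\<lambda>\<omega>. dist_to_projection d \<mu>1 \<mu>2 (\<lambda>i. \<epsilon> \<sigma> i \<omega>))) \<longlongrightarrow> 0) (at_right 0)"
proof -
  let ?D = "\<lambda>\<sigma> \<omega>. dist_to_projection d \<mu>1 \<mu>2 (\<lambda>i. \<epsilon> \<sigma> i \<omega>)"
  let ?E = "\<lambda>\<sigma>. prob_space.expectation (M \<sigma>) (?D \<sigma>)"
  have d: "2 \<le> d" using assms(1) by simp
  have D: "integrable (M \<sigma>) (?D \<sigma>)" "0 \<le> ?E \<sigma>" "?E \<sigma> \<le> 2 * \<sigma> * sqrt (2 * ln (real d))"
    if "0 < \<sigma>" for \<sigma>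
    using prob_space.expected_spread_normal[OF assms(2)[OF that] d that assms(4)[OF that]]
    unfolding dist_to_projection_eq[OF assms(1)] by auto
  have "((\<lambda>\<sigma>. 2 * \<sigma> * sqrt (2 * ln (real d))) \<longlongrightarrow> 2 * 0 * sqrt (2 * ln (real d))) (at_right 0)"
    by (intro tendsto_intros)
  then have "(?E \<longlongrightarrow> 0) (at_right 0)"
    by (intro tendsto_sandwich[of "\<lambda>_. 0" ?E "at_right 0" "\<lambda>\<sigma>. 2 * \<sigma> * sqrt (2 * ln (real d))"])
       (auto simp: eventually_at_right_less D intro!: eventually_at_rightI[of 0 1])
  then show ?thesis
    using D dist_to_projection_eq[OF assms(1)] by auto
qed

end
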